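(* Let $M$ be a non-empty subset of $\mathbb C^{n\times n}\times\mathbb C^{n\times n}$ such that if $(A,B),(C,D)\in M$ then the matrices $AB^t$, $AD^t-BC^t$ and $CD^t$ are symmetric. Then the complex vector space $$\mathcal E_M=\{\phi:\mathrm U^*(2n)\to\mathbb C\ |\ \phi(q)=\mathrm{trace}(Az^t+Bw^t),\ (A,B)\in M\}$$ is an eigenfamily on $\mathrm U^*(2n)$, where $z,w$ denote the blocks of $q=\begin{pmatrix} z& w\\ -\bar w&\bar z\end{pmatrix}\in \mathrm U^*(2n)$.
   Context: $\mathrm U^*(2n)$ is the Lie group of invertible complex $2n\times2n$ matrices of the form $q=\begin{pmatrix} z& w\\ -\bar w&\bar z\end{pmatrix}$ with $z,w\in\mathbb C^{n\times n}$; its Lie algebra consists of all matrices $\begin{pmatrix} Z& W\\ -\bar W&\bar Z\end{pmatrix}$ with $Z,W\in\mathbb C^{n\times n}$. It carries its standard left-invariant Riemannian metric, induced by the scalar product $g(Z,W)=\mathrm{Re}\,\mathrm{trace}(ZW^* )$ on the Lie algebra. For complex valued functions $\phi,\psi$ on a Lie group with left-invariant Riemannian metric, the Laplacian (tension field) $\tau$ and the operator $\kappa(\phi,\psi)=g(\mathrm{grad}(\phi),\mathrm{grad}(\psi))$ ($g$ extended complex bilinearly) are given by $\tau(\phi)=\sum_{Z\in\mathcal B}Z^2(\phi)$ and $\kappa(\phi,\psi)=\sum_{Z\in\mathcal B}Z(\phi)Z(\psi)$, where $\mathcal B$ is any orthonormal basis of the Lie algebra of left-invariant vector fields, $Z(\phi)(p)=\frac{d}{ds}[\phi(p\cdot\exp(sZ))]|_{s=0}$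 and $Z^2(\phi)(p)=\frac{d^2}{ds^2}[\phi(p\cdot\exp(sZ))]|_{s=0}$. A set $\mathcal E$ of complex valued functions is an eigenfamily if there exist $\lambda,\mu\in\mathbb C$ with $\tau(\phi)=\lambda\phi$ and $\kappa(\phi,\psi)=\mu\phi\psi$ for all $\phi,\psi\in\mathcal E$. *)

theory Defs
  imports "HOL-Analysis.Analysis"
begin

section \<open>Matrix Lie groups and their differential operators\<close>

definition mat_power :: "complex^'m^'m \<Rightarrow> nat \<Rightarrow> complex^'m^'m" where
  "mat_power X k = ((\<lambda>Y. X ** Y) ^^ k) (mat 1)"

text \<open>The type of square matrices is not an instance of the class of normed algebras, so the
  library constant \<^const>\<open>exp\<close> is not available for matrices.\<close>

definition mat_exp :: "complex^'m^'m \<Rightarrow> complex^'m^'m" where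
  "mat_exp X = (\<Sum>k. mat_power X k /\<^sub>R fact k)"

definition mat_scalar_prod :: "complex^'m^'m \<Rightarrow> complex^'m^'m \<Rightarrow> real" where
  "mat_scalar_prod Z W = Re (trace (Z ** transpose (map_matrix cnj W)))"

definition is_orthonormal_basis :: "(complex^'m^'m) set \<Rightarrow> (complex^'m^'m) set \<Rightarrow> bool" where
  "is_orthonormal_basis L B \<longleftrightarrow>
     finite B \<and> span B = L \<and>
     (\<forall>Z\<in>B. \<forall>W\<in>B. mat_scalar_prod Z W = (if Z = W then 1 else 0))"

text \<open>Functions on a matrix group \<open>G\<close> are represented by functions on all matrices; the operators
  below only look at their values on \<open>G\<close> when \<open>p \<in> G\<close> and \<open>Z\<close> lies in the Lie algebra of \<open>G\<close>.\<close>

definition one_param_curve ::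
  "complex^'m^'m \<Rightarrow> (complex^'m^'m \<Rightarrow> complex) \<Rightarrow> complex^'m^'m \<Rightarrow> real \<Rightarrow> complex" where
  "one_param_curve Z \<phi> p s = \<phi> (p ** mat_exp (s *\<^sub>R Z))"

definition lie_deriv ::
  "complex^'m^'m \<Rightarrow> (complex^'m^'m \<Rightarrow> complex) \<Rightarrow> complex^'m^'m \<Rightarrow> complex" where
  "lie_deriv Z \<phi> p = vector_derivative (one_param_curve Z \<phi> p) (at 0)"

definition lie_deriv2 ::
  "complex^'m^'m \<Rightarrow> (complex^'m^'m \<Rightarrow> complex) \<Rightarrow> complex^'m^'m \<Rightarrow> complex" where
  "lie_deriv2 Z \<phi> p =
     vector_derivative (\<lambda>t. vector_derivative (one_param_curve Z \<phi> p) (at t)) (at 0)"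

definition tension ::
  "(complex^'m^'m) set \<Rightarrow> (complex^'m^'m \<Rightarrow> complex) \<Rightarrow> complex^'m^'m \<Rightarrow> complex" where
  "tension B \<phi> p = (\<Sum>Z\<in>B. lie_deriv2 Z \<phi> p)"

definition kappa :: "(complex^'m^'m) set \<Rightarrow> (complex^'m^'m \<Rightarrow> complex)
    \<Rightarrow> (complex^'m^'m \<Rightarrow> complex) \<Rightarrow> complex^'m^'m \<Rightarrow> complex" where
  "kappa B \<phi> \<psi> p = (\<Sum>Z\<in>B. lie_deriv Z \<phi> p * lie_deriv Z \<psi> p)"

text \<open>The derivatives entering the operators exist; \<^const>\<open>vector_derivative\<close> has an
  unspecified value otherwise.\<close>

definition twice_differentiable_along ::
  "(complex^'m^'m) set \<Rightarrow> (complex^'m^'m) set \<Rightarrow> (complex^'m^'m \<Rightarrow> complex) \<Rightarrow> bool" where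
  "twice_differentiable_along G L \<phi> \<longleftrightarrow>
     (\<forall>p\<in>G. \<forall>Z\<in>L.
        (\<forall>s. one_param_curve Z \<phi> p differentiable (at s)) \<and>
        (\<lambda>t. vector_derivative (one_param_curve Z \<phi> p) (at t)) differentiable (at 0))"

text \<open>The operators do not depend on the choice of the orthonormal basis; accordingly the equations
  are required for every orthonormal basis, with the same \<open>\<lambda>\<close> and \<open>\<mu>\<close>. The lemma
  \<open>orthonormal_basis_exists\<close> below shows that this quantification is not vacuous.\<close>

definition eigenfamily ::
  "(complex^'m^'m) set \<Rightarrow> (complex^'m^'m) set \<Rightarrow> (complex^'m^'m \<Rightarrow> complex) set \<Rightarrow> bool" where
  "eigenfamily G L E \<longleftrightarrow>
     (\<forall>\<phi>\<in>E. twice_differentiable_along G L \<phi>) \<and>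
     (\<exists>l m. \<forall>B. is_orthonormal_basis L B \<longrightarrow>
        (\<forall>\<phi>\<in>E. \<forall>p\<in>G. tension B \<phi> p = l * \<phi> p) \<and>
        (\<forall>\<phi>\<in>E. \<forall>\<psi>\<in>E. \<forall>p\<in>G. kappa B \<phi> \<psi> p = m * \<phi> p * \<psi> p))"

lemma mat_scalar_prod_eq_inner: "mat_scalar_prod Z W = Z \<bullet> W"
  by (simp add: mat_scalar_prod_def trace_def matrix_matrix_mult_def transpose_def
      map_matrix_def inner_vec_def inner_complex_def)

lemma orthonormal_basis_exists:
  fixes L :: "(complex^'m^'m) set"
  assumes "subspace L"
  shows "\<exists>B. is_orthonormal_basis L B"
proof -
  obtain B where B: "B \<subseteq> L" "pairwise orthogonal B" "\<And>x. x \<in> B \<Longrightarrow> norm x = 1"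
      "independent B" "span B = L"
    using orthonormal_basis_subspace[OF assms] by metis
  have "Z \<bullet> W = (if Z = W then 1 else 0)" if "Z \<in> B" "W \<in> B" for Z W
    using B(2) B(3)[OF that(1)] that
    by (auto simp: pairwise_def orthogonal_def dot_square_norm)
  then show ?thesis
    using B(4,5) independent_imp_finite
    unfolding is_orthonormal_basis_def mat_scalar_prod_eq_inner by blast
qed


section \<open>The group $U^*(2n)$\<close>

text \<open>The index type \<open>'n + 'n\<close> has $2n$ elements; \<open>Inl\<close> and \<open>Inr\<close> index the first and the second
  block.\<close>

definition quat_matrix :: "complex^'n^'n \<Rightarrow> complex^'n^'n \<Rightarrow> complex^('n + 'n)^('n + 'n)" where
  "quat_matrix z w = (\<chi> r c. case (r, c) of
       (Inl i, Inl j) \<Rightarrow> z $ i $ j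
     | (Inl i, Inr j) \<Rightarrow> w $ i $ j
     | (Inr i, Inl j) \<Rightarrow> - cnj (w $ i $ j)
     | (Inr i, Inr j) \<Rightarrow> cnj (z $ i $ j))"

definition ustar_group :: "(complex^('n::finite + 'n)^('n + 'n)) set" where
  "ustar_group = {quat_matrix z w |z w. invertible (quat_matrix z w)}"

definition ustar_algebra :: "(complex^('n::finite + 'n)^('n + 'n)) set" where
  "ustar_algebra = {quat_matrix Z W |Z W. True}"

definition block_z :: "complex^('n + 'n)^('n + 'n) \<Rightarrow> complex^'n^'n" where
  "block_z q = (\<chi> i j. q $ Inl i $ Inl j)"

definition block_w :: "complex^('n + 'n)^('n + 'n) \<Rightarrow> complex^'n^'n" where
  "block_w q = (\<chi> i j. q $ Inl i $ Inr j)"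

lemma blocks_quat_matrix:
  "block_z (quat_matrix z w) = z" "block_w (quat_matrix z w) = w"
  by (simp_all add: block_z_def block_w_def quat_matrix_def vec_eq_iff)

lemma subspace_ustar_algebra: "subspace ustar_algebra"
proof -
  have add: "quat_matrix z w + quat_matrix z' w' = quat_matrix (z + z') (w + w')"
    for z w z' w' :: "complex^'n^'n"
    by (auto simp: quat_matrix_def vec_eq_iff split: sum.split)
  have scale: "r *\<^sub>R quat_matrix z w = quat_matrix (r *\<^sub>R z) (r *\<^sub>R w)"
    for r and z w :: "complex^'n^'n"
    by (auto simp: quat_matrix_def vec_eq_iff split: sum.split)
  have zero: "0 = quat_matrix (0 :: complex^'n^'n) 0"
    by (auto simp: quat_matrix_def vec_eq_iff split: sum.split)
  show ?thesis
    unfolding subspace_def ustar_algebra_def using add scale zero by blast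
qed

text \<open>Functions on the group are extensional, i.e. \<^const>\<open>undefined\<close> outside of it.\<close>

definition family_of ::
  "((complex^'n^'n) \<times> (complex^'n^'n)) set \<Rightarrow> (complex^('n + 'n)^('n + 'n) \<Rightarrow> complex) set" where
  "family_of M =
     {restrict (\<lambda>q. trace (A ** transpose (block_z q) + B ** transpose (block_w q))) ustar_group
       |A B. (A, B) \<in> M}"

definition complex_span_on :: "'a set \<Rightarrow> ('a \<Rightarrow> complex) set \<Rightarrow> ('a \<Rightarrow> complex) set" where
  "complex_span_on G E =
     {restrict (\<lambda>q. \<Sum>\<phi>\<in>F. c \<phi> * \<phi> q) G |F c. finite F \<and> F \<subseteq> E}"

end

theory Submission
  imports Defs
begin

text \<open>The eigenvalues are \<open>\<lambda> = -1\<close> and \<open>\<mu> = 0\<close>.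

  Write $f_{A,B}(q) = \mathrm{trace}(Az^t + Bw^t)$. This function is linear in \<open>q\<close>, so along
  $s \mapsto p\exp(sZ)$ its first and second derivatives at $0$ are $f_{A,B}(pZ)$ and
  $f_{A,B}(pZ^2)$ (\<open>lie_deriv_linear\<close>). Both operators are therefore governed by the sums
  $\sum_{Z\in\mathcal B} Z_{rc}Z_{kl}$ of products of matrix entries. The Lie algebra is the
  fixed point set of the conjugate-linear involution $X \mapsto J\bar XJ^{-1}$, where
  $J$ has the block rows $(0 \mid I)$ and $(-I \mid 0)$, and the projection onto it gives
  $\sum_{Z} Z_{rc}Z_{kl} = J_{rk}J_{cl}$ for every orthonormal basis (\<open>sum_basis_entries\<close>).

  Contracting $c$ with $k$ yields $\sum_Z Z^2 = J^2 = -I$, that is, $\tau(f_{A,B}) = -f_{A,B}$.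
  For \<open>\<kappa>\<close> the identity separates the dependence on the point $p$, with blocks $z, w$, from the
  dependence on the coefficients:
  $$\kappa(f_{A,B}, f_{C,D})(p) = \sum_{i,j} (zw^t - wz^t)_{ij}\,(AD^t - BC^t)_{ij}.$$
  The first factor is skew in $i, j$ and the second is symmetric by hypothesis, so the sum
  vanishes. Since the equations are linear and bilinear in the functions, they extend to the
  complex span (\<open>eigenfamily_complex_span\<close>).\<close>

section \<open>The matrix exponential\<close>

lemma bounded_bilinear_matrix_mult:
  "bounded_bilinear ((**) :: complex^'m^'m \<Rightarrow> complex^'m^'m \<Rightarrow> complex^'m^'m)"
  unfolding bilinear_conv_bounded_bilinear[symmetric] bilinear_def linear_iff
  by (auto simp: matrix_matrix_mult_def vec_eq_iff algebra_simps sum.distrib scaleR_sum_right)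

interpretation mat_mult: bounded_bilinear
  "(**) :: complex^'m^'m \<Rightarrow> complex^'m^'m \<Rightarrow> complex^'m^'m"
  by (rule bounded_bilinear_matrix_mult)

lemma mat_power_simps:
  "mat_power X 0 = mat 1"
  "mat_power X (Suc k) = X ** mat_power X k"
  by (simp_all add: mat_power_def)

lemma mat_power_commute: "mat_power X k ** X = X ** mat_power X k"
  by (induction k) (simp_all add: mat_power_simps flip: matrix_mul_assoc)

lemma mat_power_scaleR: "mat_power (s *\<^sub>R X) k = s ^ k *\<^sub>R mat_power X k"
proof (induction k)
  case (Suc k)
  then show ?case
    by (simp add: mat_power_simps(2) mat_mult.scaleR_left mat_mult.scaleR_right)
qed (simp add: mat_power_simps)

lemma summable_mat_exp:
  fixes X :: "complex^'m^'m"
  shows "summable (\<lambda>k. mat_power X k /\<^sub>R fact k)"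
proof -
  \<comment> \<open>The Euclidean norm of matrices is used through boundedness of the product alone, so a
    constant factor \<open>K\<close> stands in for submultiplicativity.\<close>
  obtain K where K: "K > 0" "\<And>(A :: complex^'m^'m) (B :: complex^'m^'m). norm (A ** B) \<le> norm A * norm B * K"
    using mat_mult.pos_bounded by blast
  let ?I = "norm (mat 1 :: complex^'m^'m)"
  have bound: "norm (mat_power X k) \<le> ?I * (norm X * K) ^ k" for k
  proof (induction k)
    case (Suc k)
    have "norm (mat_power X (Suc k)) \<le> norm (mat_power X k) * (norm X * K)"
      using K(2)[of X "mat_power X k"] by (simp add: mat_power_simps ac_simps)
    also have "\<dots> \<le> ?I * (norm X * K) ^ k * (norm X * K)"
      using Suc K(1) by (intro mult_right_mono) auto
    finally show ?case by (simp add: ac_simps)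
  qed (simp add: mat_power_simps)
  show ?thesis
  proof (rule summable_comparison_test)
    show "summable (\<lambda>k. ?I * (inverse (fact k) * (norm X * K) ^ k))"
      by (intro summable_mult summable_exp)
    show "\<exists>N. \<forall>k\<ge>N. norm (mat_power X k /\<^sub>R fact k) \<le> ?I * (inverse (fact k) * (norm X * K) ^ k)"
      using bound by (auto simp: field_simps)
  qed
qed

text \<open>Continuous real-linear maps can be evaluated termwise, which reduces identities for the
  exponential to identities for powers.\<close>

lemma bounded_linear_mat_exp:
  assumes "bounded_linear h"
  shows "h (mat_exp X) = (\<Sum>k. h (mat_power X k) /\<^sub>R fact k)"
  unfolding mat_exp_def bounded_linear.suminf[OF assms summable_mat_exp]
  by (simp add: linear_simps[OF assms])

lemma mat_exp_0: "mat_exp (0 :: complex^'m^'m) = mat 1"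
proof -
  have "mat_power 0 k /\<^sub>R fact k = (if k = 0 then mat 1 else 0 :: complex^'m^'m)" for k
    by (cases k) (simp_all add: mat_power_simps mat_mult.zero_left)
  then show ?thesis
    using sums_single[of 0 "\<lambda>_. mat 1 :: complex^'m^'m"] by (simp add: mat_exp_def sums_iff)
qed

lemma mat_exp_commute: "mat_exp (s *\<^sub>R X) ** X = X ** mat_exp (s *\<^sub>R X)"
  by (simp add: bounded_linear_mat_exp[OF mat_mult.bounded_linear_left]
      bounded_linear_mat_exp[OF mat_mult.bounded_linear_right]
      mat_power_scaleR mat_mult.scaleR_left mat_mult.scaleR_right mat_power_commute)

text \<open>Each real coordinate of $s \mapsto \exp(sX)$ is an everywhere convergent power series in
  \<open>s\<close>, so termwise differentiation of scalar power series applies coordinatewise.\<close>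

lemma has_vector_derivative_mat_exp:
  fixes X :: "complex^'m^'m"
  shows "((\<lambda>s. mat_exp (s *\<^sub>R X)) has_vector_derivative X ** mat_exp (s *\<^sub>R X)) (at s)"
  unfolding has_vector_derivative_def
proof (subst has_derivative_componentwise_within, intro ballI)
  fix i :: "complex^'m^'m" assume "i \<in> Basis"
  define c where "c k = (mat_power X k \<bullet> i) / fact k" for k
  have exp_coord: "mat_exp (t *\<^sub>R X) \<bullet> i = (\<Sum>k. c k * t ^ k)" for t
    by (subst bounded_linear_mat_exp[OF bounded_linear_inner_left])
      (simp add: mat_power_scaleR c_def field_simps)
  have "(X ** mat_exp (s *\<^sub>R X)) \<bullet> i = (\<Sum>k. diffs c k * s ^ k)"
    by (subst bounded_linear_mat_exp[OF bounded_linear_compose[OF bounded_linear_inner_left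
          mat_mult.bounded_linear_right]])
      (simp add: mat_power_scaleR mat_mult.scaleR_right c_def diffs_def mat_power_simps
        field_simps del: of_nat_Suc)
  moreover have "summable (\<lambda>k. c k * t ^ k)" for t
    using bounded_linear.summable[OF bounded_linear_inner_left summable_mat_exp, of "t *\<^sub>R X" i]
    by (simp add: mat_power_scaleR c_def field_simps)
  ultimately show "((\<lambda>t. mat_exp (t *\<^sub>R X) \<bullet> i) has_derivative
      (\<lambda>h. (h *\<^sub>R (X ** mat_exp (s *\<^sub>R X))) \<bullet> i)) (at s)"
    using termdiffs_strong_converges_everywhere[of c s]
    by (simp add: exp_coord has_field_derivative_def mult.commute[of _ "suminf _"])
qed

text \<open>The derivative of $\exp(-sX)\exp(sX)$ vanishes, so this product keeps its value at
  $s = 0$.\<close>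

lemma invertible_mat_exp:
  fixes X :: "complex^'m^'m"
  shows "invertible (mat_exp X)"
proof -
  let ?f = "\<lambda>s. mat_exp (s *\<^sub>R (- X)) ** mat_exp (s *\<^sub>R X)"
  have "(?f has_vector_derivative 0) (at s)" for s
  proof -
    have "(?f has_vector_derivative mat_exp (s *\<^sub>R (- X)) ** (X ** mat_exp (s *\<^sub>R X))
        + (- X ** mat_exp (s *\<^sub>R (- X))) ** mat_exp (s *\<^sub>R X)) (at s)"
      by (rule mat_mult.has_vector_derivative[OF has_vector_derivative_mat_exp
            has_vector_derivative_mat_exp])
    moreover have "mat_exp (s *\<^sub>R (- X)) ** X = X ** mat_exp (s *\<^sub>R (- X))"
      using mat_exp_commute[of s "- X"] by (simp add: mat_mult.minus_left mat_mult.minus_right)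
    ultimately show ?thesis
      by (simp add: mat_mult.minus_left matrix_mul_assoc)
  qed
  then obtain c where c: "\<And>s. ?f s = c"
    using has_vector_derivative_zero_constant[of UNIV ?f] by auto
  have "mat_exp (- X) ** mat_exp X = mat 1"
    using c[of 0] c[of 1] by (simp add: mat_exp_0)
  then show ?thesis
    using invertible_left_inverse by blast
qed

section \<open>Differential operators along one-parameter groups\<close>

lemma orthonormal_basis_mem: "is_orthonormal_basis L B \<Longrightarrow> Z \<in> B \<Longrightarrow> Z \<in> L"
  using span_base by (auto simp: is_orthonormal_basis_def)

text \<open>A real-linear function commutes with differentiation, so only the exponential is
  differentiated and each derivative contributes one factor \<open>Z\<close>. Agreement of \<open>\<phi>\<close> with a linear \<open>f\<close> is
  asked for on \<open>G\<close> alone, so that extensional functions are covered; hence the curve must stay in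
  \<open>G\<close>.\<close>

lemma one_param_curve_linear:
  fixes f :: "complex^'m^'m \<Rightarrow> complex"
  assumes f: "linear f"
    and curve: "\<And>s. p ** mat_exp (s *\<^sub>R Z) \<in> G"
    and \<phi>: "\<And>q. q \<in> G \<Longrightarrow> \<phi> q = f q"
  shows "(one_param_curve Z \<phi> p has_vector_derivative f (p ** (Z ** mat_exp (s *\<^sub>R Z)))) (at s)"
    and "((\<lambda>t. vector_derivative (one_param_curve Z \<phi> p) (at t)) has_vector_derivative
           f (p ** (Z ** (Z ** mat_exp (s *\<^sub>R Z))))) (at s)"
proof -
  interpret f: bounded_linear f
    using f by (simp add: linear_conv_bounded_linear)
  have curve_eq: "one_param_curve Z \<phi> p = (\<lambda>s. f (p ** mat_exp (s *\<^sub>R Z)))"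
    using curve \<phi> by (auto simp: one_param_curve_def)
  have first: "(one_param_curve Z \<phi> p has_vector_derivative f (p ** (Z ** mat_exp (s *\<^sub>R Z)))) (at s)"
    for s
    unfolding curve_eq
    by (intro f.has_vector_derivative has_vector_derivative_mat_exp
        bounded_linear.has_vector_derivative[OF mat_mult.bounded_linear_right])
  then show "(one_param_curve Z \<phi> p has_vector_derivative f (p ** (Z ** mat_exp (s *\<^sub>R Z)))) (at s)" .
  show "((\<lambda>t. vector_derivative (one_param_curve Z \<phi> p) (at t)) has_vector_derivative
           f (p ** (Z ** (Z ** mat_exp (s *\<^sub>R Z))))) (at s)"
    unfolding vector_derivative_at[OF first]
    by (intro f.has_vector_derivative has_vector_derivative_mat_exp
        bounded_linear.has_vector_derivative[OF mat_mult.bounded_linear_right])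
qed

lemma lie_deriv_linear:
  fixes f :: "complex^'m^'m \<Rightarrow> complex"
  assumes "linear f"
    and "\<And>s. p ** mat_exp (s *\<^sub>R Z) \<in> G"
    and "\<And>q. q \<in> G \<Longrightarrow> \<phi> q = f q"
  shows "lie_deriv Z \<phi> p = f (p ** Z)" "lie_deriv2 Z \<phi> p = f (p ** (Z ** Z))"
  unfolding lie_deriv_def lie_deriv2_def
  using one_param_curve_linear[where s = 0, OF assms, THEN vector_derivative_at]
  by (simp_all add: mat_exp_0)

lemma twice_differentiable_along_linear:
  fixes f :: "complex^'m^'m \<Rightarrow> complex"
  assumes "linear f"
    and "\<And>p Z s. p \<in> G \<Longrightarrow> Z \<in> L \<Longrightarrow> p ** mat_exp (s *\<^sub>R Z) \<in> G"
    and "\<And>q. q \<in> G \<Longrightarrow> \<phi> q = f q"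
  shows "twice_differentiable_along G L \<phi>"
  unfolding twice_differentiable_along_def
  using one_param_curve_linear[of f _ _ G \<phi>, OF assms(1) _ assms(3)] assms(2)
  by (meson differentiableI_vector)


text \<open>The tension field is linear and \<open>\<kappa>\<close> is bilinear, so both eigenvalue equations pass from a family
  to its linear span. The curves have to stay in the group, because the members of
  \<^const>\<open>complex_span_on\<close> are linear combinations there only. Differentiability of the curves of
  the given family is what makes the derivatives additive.\<close>

lemma eigenfamily_complex_span:
  fixes G L :: "(complex^'m^'m) set"
  assumes E: "eigenfamily G L E"
    and curve: "\<And>p Z s. p \<in> G \<Longrightarrow> Z \<in> L \<Longrightarrow> p ** mat_exp (s *\<^sub>R Z) \<in> G"
  shows "eigenfamily G L (complex_span_on G E)"
proof -
  define comb where "comb F c = restrict (\<lambda>q. \<Sum>\<phi>\<in>F. c \<phi> * \<phi> q) G"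
    for F :: "(complex^'m^'m \<Rightarrow> complex) set" and c
  have span: "complex_span_on G E = {comb F c |F c. finite F \<and> F \<subseteq> E}"
    by (simp add: complex_span_on_def comb_def)
  have diff: "one_param_curve Z \<phi> p differentiable (at s)"
      "(\<lambda>t. vector_derivative (one_param_curve Z \<phi> p) (at t)) differentiable (at 0)"
    if "\<phi> \<in> E" "p \<in> G" "Z \<in> L" for \<phi> p Z s
    using E that unfolding eigenfamily_def twice_differentiable_along_def by blast+
  have curve_comb: "one_param_curve Z (comb F c) p = (\<lambda>s. \<Sum>\<phi>\<in>F. c \<phi> * one_param_curve Z \<phi> p s)"
    if "p \<in> G" "Z \<in> L" for F c p Z
    using curve[OF that] by (auto simp: one_param_curve_def comb_def)
  have first: "(one_param_curve Z (comb F c) p has_vector_derivative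
        (\<Sum>\<phi>\<in>F. c \<phi> * vector_derivative (one_param_curve Z \<phi> p) (at s))) (at s)"
    if "F \<subseteq> E" "p \<in> G" "Z \<in> L" for F c p Z s
    unfolding curve_comb[OF that(2,3)] using that diff(1)
    by (intro has_vector_derivative_sum has_vector_derivative_mult_right)
      (auto simp flip: vector_derivative_works)
  have second: "((\<lambda>t. vector_derivative (one_param_curve Z (comb F c) p) (at t)) has_vector_derivative
        (\<Sum>\<phi>\<in>F. c \<phi> * lie_deriv2 Z \<phi> p)) (at 0)"
    if "F \<subseteq> E" "p \<in> G" "Z \<in> L" for F c p Z
    unfolding vector_derivative_at[OF first[OF that]] lie_deriv2_def using that diff(2)
    by (intro has_vector_derivative_sum has_vector_derivative_mult_right)
      (auto simp flip: vector_derivative_works)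
  have lie: "lie_deriv Z (comb F c) p = (\<Sum>\<phi>\<in>F. c \<phi> * lie_deriv Z \<phi> p)"
      "lie_deriv2 Z (comb F c) p = (\<Sum>\<phi>\<in>F. c \<phi> * lie_deriv2 Z \<phi> p)"
    if "F \<subseteq> E" "p \<in> G" "Z \<in> L" for F c p Z
    using first[OF that, THEN vector_derivative_at] second[OF that, THEN vector_derivative_at]
    by (simp_all add: lie_deriv_def lie_deriv2_def[of Z "comb F c"])
  have twice: "twice_differentiable_along G L (comb F c)" if "F \<subseteq> E" for F c
    unfolding twice_differentiable_along_def
    using first[OF that] second[OF that] by (blast intro: differentiableI_vector)
  obtain l m where eigen: "\<And>B. is_orthonormal_basis L B \<Longrightarrow>
        (\<forall>\<phi>\<in>E. \<forall>p\<in>G. tension B \<phi> p = l * \<phi> p) \<and>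
        (\<forall>\<phi>\<in>E. \<forall>\<psi>\<in>E. \<forall>p\<in>G. kappa B \<phi> \<psi> p = m * \<phi> p * \<psi> p)"
    using E unfolding eigenfamily_def by blast
  have "(\<forall>\<phi>\<in>complex_span_on G E. \<forall>p\<in>G. tension B \<phi> p = l * \<phi> p) \<and>
      (\<forall>\<phi>\<in>complex_span_on G E. \<forall>\<psi>\<in>complex_span_on G E. \<forall>p\<in>G.
         kappa B \<phi> \<psi> p = m * \<phi> p * \<psi> p)"
    if B: "is_orthonormal_basis L B" for B
  proof -
    note BL = orthonormal_basis_mem[OF B]
    have "tension B (comb F c) p = l * comb F c p" if "F \<subseteq> E" "p \<in> G" for F c p
    proof -
      have "tension B (comb F c) p = (\<Sum>Z\<in>B. \<Sum>\<phi>\<in>F. c \<phi> * lie_deriv2 Z \<phi> p)"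
        unfolding tension_def using lie(2) that BL by (intro sum.cong) auto
      also have "\<dots> = (\<Sum>\<phi>\<in>F. c \<phi> * tension B \<phi> p)"
        unfolding tension_def sum_distrib_left by (rule sum.swap)
      also have "\<dots> = (\<Sum>\<phi>\<in>F. c \<phi> * (l * \<phi> p))"
        using eigen[OF B] that by (intro sum.cong) auto
      finally show ?thesis
        using that by (simp add: comb_def sum_distrib_left ac_simps)
    qed
    moreover have "kappa B (comb F c) (comb F' c') p = m * comb F c p * comb F' c' p"
      if "F \<subseteq> E" "F' \<subseteq> E" "p \<in> G" for F F' c c' p
    proof -
      have "kappa B (comb F c) (comb F' c') p = (\<Sum>Z\<in>B. \<Sum>\<phi>\<in>F. \<Sum>\<psi>\<in>F'.
          c \<phi> * c' \<psi> * (lie_deriv Z \<phi> p * lie_deriv Z \<psi> p))"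
        unfolding kappa_def
        by (intro sum.cong refl) (simp add: lie(1) that BL sum_product, simp add: ac_simps)
      also have "\<dots> = (\<Sum>\<phi>\<in>F. \<Sum>\<psi>\<in>F'. c \<phi> * c' \<psi> * kappa B \<phi> \<psi> p)"
        unfolding kappa_def sum_distrib_left
        by (subst sum.swap) (intro sum.cong refl sum.swap)
      also have "\<dots> = (\<Sum>\<phi>\<in>F. \<Sum>\<psi>\<in>F'. c \<phi> * c' \<psi> * (m * \<phi> p * \<psi> p))"
        using eigen[OF B] that by (intro sum.cong refl) (metis subsetD)
      also have "\<dots> = m * ((\<Sum>\<phi>\<in>F. c \<phi> * \<phi> p) * (\<Sum>\<psi>\<in>F'. c' \<psi> * \<psi> p))"
        by (simp add: sum_product sum_distrib_left ac_simps)
      finally show ?thesis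
        using that by (simp add: comb_def ac_simps)
    qed
    ultimately show ?thesis
      unfolding span by blast
  qed
  moreover have "\<forall>\<phi>\<in>complex_span_on G E. twice_differentiable_along G L \<phi>"
    using twice unfolding span by blast
  ultimately show ?thesis
    unfolding eigenfamily_def by blast
qed

section \<open>The quaternionic structure\<close>

text \<open>The matrix $J$ is encoded by its only non-zero entries $J_{rc}$, which are those with
  \<open>c = other_block r\<close> and have the value \<open>block_sign r\<close>.\<close>

definition other_block :: "'n + 'n \<Rightarrow> 'n + 'n" where
  "other_block = case_sum Inr Inl"

definition block_sign :: "'n + 'n \<Rightarrow> complex" where
  "block_sign = case_sum (\<lambda>_. 1) (\<lambda>_. -1)"

lemma other_block_simps [simp]:
  "other_block (Inl i) = Inr i" "other_block (Inr i) = Inl i"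
  "other_block (other_block r) = r"
  by (auto simp: other_block_def split: sum.split)

lemma block_sign_simps [simp]:
  "block_sign (Inl i) = 1" "block_sign (Inr i) = -1"
  "block_sign (other_block r) = - block_sign r"
  "block_sign r * block_sign r = 1" "cnj (block_sign r) = block_sign r"
  by (auto simp: block_sign_def other_block_def split: sum.split)

lemma sum_other_block: "(\<Sum>r\<in>UNIV. f (other_block r)) = (\<Sum>r\<in>UNIV. f r)"
  by (rule sum.reindex_bij_witness[where i = other_block and j = other_block]) auto

lemma sum_UNIV_blocks:
  fixes f :: "'n::finite + 'n \<Rightarrow> 'a::comm_monoid_add"
  shows "(\<Sum>c\<in>UNIV. f c) = (\<Sum>j\<in>UNIV. f (Inl j)) + (\<Sum>j\<in>UNIV. f (Inr j))"
  unfolding UNIV_sum by (subst sum.union_disjoint) (auto simp: sum.reindex)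

text \<open>The map $X \mapsto J\bar X J^{-1}$, whose fixed points are the quaternionic matrices.\<close>

definition quat_structure :: "complex^('n::finite + 'n)^('n + 'n) \<Rightarrow> complex^('n + 'n)^('n + 'n)" where
  "quat_structure X =
     (\<chi> r c. block_sign r * block_sign c * cnj (X $ other_block r $ other_block c))"

lemma ustar_algebra_iff: "X \<in> ustar_algebra \<longleftrightarrow> quat_structure X = X"
proof
  assume "X \<in> ustar_algebra"
  then show "quat_structure X = X"
    by (auto simp: ustar_algebra_def quat_structure_def quat_matrix_def vec_eq_iff split: sum.split)
next
  assume X: "quat_structure X = X"
  have "X $ r $ c = block_sign r * block_sign c * cnj (X $ other_block r $ other_block c)" for r c
    using arg_cong[OF X, of "\<lambda>Y. Y $ r $ c"] by (simp add: quat_structure_def)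
  from this[of "Inr _"] have "X = quat_matrix (block_z X) (block_w X)"
    by (simp add: vec_eq_iff quat_matrix_def block_z_def block_w_def split: sum.split)
  then show "X \<in> ustar_algebra"
    by (auto simp: ustar_algebra_def)
qed

lemma ustar_group_iff: "q \<in> ustar_group \<longleftrightarrow> q \<in> ustar_algebra \<and> invertible q"
  by (auto simp: ustar_group_def ustar_algebra_def)

lemma linear_quat_structure: "linear quat_structure"
  by (simp add: linear_iff quat_structure_def vec_eq_iff algebra_simps)

lemma quat_structure_mult: "quat_structure (X ** Y) = quat_structure X ** quat_structure Y"
proof -
  have "(quat_structure X ** quat_structure Y) $ r $ c = quat_structure (X ** Y) $ r $ c" for r c
  proof -
    have "(quat_structure X ** quat_structure Y) $ r $ c =
        (\<Sum>k\<in>UNIV. block_sign r * block_sign c * (block_sign k * block_sign k) *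
          (cnj (X $ other_block r $ other_block k) * cnj (Y $ other_block k $ other_block c)))"
      unfolding matrix_matrix_mult_def quat_structure_def by (simp only: vec_lambda_beta ac_simps)
    also have "\<dots> = (\<Sum>k\<in>UNIV. block_sign r * block_sign c *
          (cnj (X $ other_block r $ k) * cnj (Y $ k $ other_block c)))"
      using sum_other_block[of "\<lambda>k. block_sign r * block_sign c *
          (cnj (X $ other_block r $ k) * cnj (Y $ k $ other_block c))"] by simp
    finally show ?thesis
      by (simp add: quat_structure_def matrix_matrix_mult_def sum_distrib_left)
  qed
  then show ?thesis
    by (simp add: vec_eq_iff)
qed

lemma quat_structure_involutive: "quat_structure (quat_structure X) = X"
  by (auto simp: quat_structure_def vec_eq_iff algebra_simps)

lemma quat_structure_inner:
  fixes X Y :: "complex^('a::finite + 'a)^('a + 'a)"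
  shows "quat_structure X \<bullet> Y = X \<bullet> quat_structure Y"
proof -
  have reindex: "(\<Sum>r\<in>UNIV. \<Sum>c\<in>UNIV. f r c) =
      (\<Sum>r\<in>UNIV. \<Sum>c\<in>UNIV. f (other_block r) (other_block c))"
    for f :: "'a + 'a \<Rightarrow> 'a + 'a \<Rightarrow> real"
    by (simp add: sum_other_block[of "f r" for r] sum_other_block[of "\<lambda>r. \<Sum>c\<in>UNIV. f r c"])
  have "quat_structure X \<bullet> Y = (\<Sum>r\<in>UNIV. \<Sum>c\<in>UNIV.
      (quat_structure X $ other_block r $ other_block c) \<bullet> (Y $ other_block r $ other_block c))"
    unfolding inner_vec_def by (rule reindex)
  also have "\<dots> = X \<bullet> quat_structure Y"
    unfolding inner_vec_def
    by (intro sum.cong refl)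
      (auto simp: quat_structure_def block_sign_def inner_complex_def split: sum.split)
  finally show ?thesis .
qed

text \<open>The structure map is real-linear and multiplicative, so it commutes with the exponential.\<close>

lemma ustar_algebra_mat_exp:
  assumes "Z \<in> ustar_algebra"
  shows "mat_exp Z \<in> ustar_algebra"
proof -
  have "quat_structure (mat_power Z k) = mat_power Z k" for k
  proof (induction k)
    case 0
    show ?case
      by (auto simp: mat_power_simps quat_structure_def mat_def vec_eq_iff other_block_def block_sign_def
          split: sum.split)
  next
    case (Suc k)
    then show ?case
      using assms by (simp add: mat_power_simps quat_structure_mult ustar_algebra_iff)
  qed
  then show ?thesis
    using bounded_linear_mat_exp[of quat_structure Z] linear_quat_structure
    by (simp add: ustar_algebra_iff linear_conv_bounded_linear mat_exp_def)
qed

lemma ustar_group_curve: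
  assumes "p \<in> ustar_group" "Z \<in> ustar_algebra"
  shows "p ** mat_exp (s *\<^sub>R Z) \<in> ustar_group"
proof -
  have "mat_exp (s *\<^sub>R Z) \<in> ustar_algebra"
    using assms(2) by (intro ustar_algebra_mat_exp subspace_scale[OF subspace_ustar_algebra])
  then show ?thesis
    using assms(1) invertible_mat_exp[of "s *\<^sub>R Z"]
    by (simp add: ustar_group_iff ustar_algebra_iff quat_structure_mult invertible_mult)
qed


section \<open>Summation over an orthonormal basis\<close>

text \<open>The orthogonal projection onto the algebra is $X \mapsto (X + J\bar X J^{-1})/2$, and
  \<open>\<Sum>Z\<in>B. \<langle>X, Z\<rangle> Z\<close> is the projection of \<open>X\<close>. The entry $Z_{rc}$ is
  $\langle E_{rc}, Z\rangle + i\langle iE_{rc}, Z\rangle$; in the sum the complex-linear half of the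
  projection cancels and its antilinear half is doubled.\<close>

lemma sum_basis_entries:
  fixes B :: "(complex^('n::finite + 'n)^('n + 'n)) set"
  assumes B: "is_orthonormal_basis ustar_algebra B"
  shows "(\<Sum>Z\<in>B. Z $ r $ c * Z $ k $ l) =
    (if k = other_block r \<and> l = other_block c then block_sign r * block_sign c else 0)"
proof -
  have fin: "finite B" and span: "span B = ustar_algebra"
    and orth: "\<And>Z W. Z \<in> B \<Longrightarrow> W \<in> B \<Longrightarrow> Z \<bullet> W = (if Z = W then 1 else 0)"
    using B by (auto simp: is_orthonormal_basis_def mat_scalar_prod_eq_inner)
  define proj where "proj X = (1/2) *\<^sub>R (X + quat_structure X)"
    for X :: "complex^('n + 'n)^('n + 'n)"
  have expand: "(\<Sum>Z\<in>B. (X \<bullet> Z) *\<^sub>R Z) = proj X" for X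
  proof -
    have "proj X \<in> span B"
      unfolding span ustar_algebra_iff proj_def
      by (simp add: linear_scale[OF linear_quat_structure] linear_add[OF linear_quat_structure]
          quat_structure_involutive add.commute)
    then have "(\<Sum>Z\<in>B. (proj X \<bullet> Z) *\<^sub>R Z) = proj X"
      by (intro orthonormal_basis_expand fin) (auto simp: pairwise_def orthogonal_def orth norm_eq_1)
    moreover have "proj X \<bullet> Z = X \<bullet> Z" if "Z \<in> B" for Z
    proof -
      have "quat_structure Z = Z"
        using orthonormal_basis_mem[OF B that] by (simp add: ustar_algebra_iff)
      then show ?thesis
        by (simp add: proj_def inner_add_left quat_structure_inner)
    qed
    ultimately show ?thesis
      by simp
  qed
  define unit :: "complex \<Rightarrow> complex^('n + 'n)^('n + 'n)" where "unit u = axis r (axis c u)" for u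
  have entry: "Z $ r $ c = of_real (unit 1 \<bullet> Z) + \<i> * of_real (unit \<i> \<bullet> Z)" for Z
    by (simp add: unit_def inner_axis' inner_complex_def complex_eq_iff)
  have "(\<Sum>Z\<in>B. Z $ r $ c * Z $ k $ l) =
      (\<Sum>Z\<in>B. (unit 1 \<bullet> Z) *\<^sub>R Z) $ k $ l + \<i> * (\<Sum>Z\<in>B. (unit \<i> \<bullet> Z) *\<^sub>R Z) $ k $ l"
    by (simp add: entry scaleR_conv_of_real[where 'a = complex] sum_distrib_left algebra_simps flip: sum.distrib)
  also have "\<dots> = (if k = other_block r \<and> l = other_block c then block_sign r * block_sign c else 0)"
    unfolding expand by (auto simp: proj_def unit_def axis_def quat_structure_def
        scaleR_conv_of_real[where 'a = complex] algebra_simps)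
  finally show ?thesis .
qed

text \<open>Only the inner index \<open>c = other_block r\<close> contributes, forcing \<open>l = r\<close>, and \<open>r\<close> and \<open>c\<close> carry
  opposite signs.\<close>

lemma sum_basis_squares:
  fixes B :: "(complex^('n::finite + 'n)^('n + 'n)) set"
  assumes "is_orthonormal_basis ustar_algebra B"
  shows "(\<Sum>Z\<in>B. Z ** Z) = - mat 1"
proof -
  have "(\<Sum>Z\<in>B. Z ** Z) $ r $ l = - mat 1 $ r $ l" for r l
  proof -
    have "(\<Sum>Z\<in>B. Z ** Z) $ r $ l = (\<Sum>c\<in>UNIV. \<Sum>Z\<in>B. Z $ r $ c * Z $ c $ l)"
      unfolding sum_component matrix_matrix_mult_def vec_lambda_beta by (rule sum.swap)
    also have "\<dots> = (\<Sum>c\<in>UNIV. if c = other_block r then - mat 1 $ r $ l else 0)"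
      unfolding sum_basis_entries[OF assms] by (intro sum.cong) (auto simp: mat_def)
    finally show ?thesis
      by simp
  qed
  then show ?thesis
    by (simp add: vec_eq_iff)
qed

lemma sum_basis_linear_forms:
  fixes B :: "(complex^('n::finite + 'n)^('n + 'n)) set"
  assumes "is_orthonormal_basis ustar_algebra B"
  shows "(\<Sum>Z\<in>B. (\<Sum>r\<in>UNIV. \<Sum>c\<in>UNIV. a r c * Z $ r $ c) * (\<Sum>k\<in>UNIV. \<Sum>l\<in>UNIV. b k l * Z $ k $ l)) =
    (\<Sum>r\<in>UNIV. \<Sum>c\<in>UNIV. block_sign r * block_sign c * (a r c * b (other_block r) (other_block c)))"
proof -
  have "(\<Sum>Z\<in>B. (\<Sum>r\<in>UNIV. \<Sum>c\<in>UNIV. a r c * Z $ r $ c) * (\<Sum>k\<in>UNIV. \<Sum>l\<in>UNIV. b k l * Z $ k $ l)) =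
      (\<Sum>Z\<in>B. \<Sum>x\<in>UNIV. \<Sum>y\<in>UNIV. a (fst x) (snd x) * b (fst y) (snd y) *
        (Z $ fst x $ snd x * Z $ fst y $ snd y))"
    by (simp add: sum.cartesian_product sum_product case_prod_unfold ac_simps)
  also have "\<dots> = (\<Sum>x\<in>UNIV. \<Sum>y\<in>UNIV. a (fst x) (snd x) * b (fst y) (snd y) *
        (\<Sum>Z\<in>B. Z $ fst x $ snd x * Z $ fst y $ snd y))"
    unfolding sum_distrib_left by (subst sum.swap) (intro sum.cong refl sum.swap)
  also have "\<dots> = (\<Sum>x\<in>UNIV. \<Sum>y\<in>UNIV. if y = (other_block (fst x), other_block (snd x))
        then block_sign (fst x) * block_sign (snd x) * (a (fst x) (snd x) * b (fst y) (snd y)) else 0)"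
    unfolding sum_basis_entries[OF assms] by (intro sum.cong refl) (auto simp: prod_eq_iff)
  also have "\<dots> = (\<Sum>x\<in>UNIV. block_sign (fst x) * block_sign (snd x) *
        (a (fst x) (snd x) * b (other_block (fst x)) (other_block (snd x))))"
    by simp
  finally show ?thesis
    by (simp add: sum.cartesian_product case_prod_unfold)
qed

section \<open>The trace functions\<close>

definition trace_form ::
  "complex^'n^'n \<Rightarrow> complex^'n^'n \<Rightarrow> complex^('n::finite + 'n)^('n + 'n) \<Rightarrow> complex" where
  "trace_form A B q = trace (A ** transpose (block_z q) + B ** transpose (block_w q))"

text \<open>The \<open>i\<close>-th row of the $n \times 2n$ matrix $(A \mid B)$.\<close>

definition block_row :: "complex^'n^'n \<Rightarrow> complex^'n^'n \<Rightarrow> 'n \<Rightarrow> 'n + 'n \<Rightarrow> complex" where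
  "block_row A B i = case_sum (\<lambda>j. A $ i $ j) (\<lambda>j. B $ i $ j)"

text \<open>The complex bilinear form $x^tJy$.\<close>

definition symplectic :: "('n::finite + 'n \<Rightarrow> complex) \<Rightarrow> ('n + 'n \<Rightarrow> complex) \<Rightarrow> complex" where
  "symplectic x y = (\<Sum>c\<in>UNIV. block_sign c * (x c * y (other_block c)))"

lemma symplectic_skew: "symplectic y x = - symplectic x y"
  using sum_other_block[of "\<lambda>c. block_sign c * (y c * x (other_block c))"]
  by (simp add: symplectic_def sum_negf ac_simps)

lemma symplectic_block_row:
  "symplectic (block_row A B i) (block_row C D j) = (A ** transpose D - B ** transpose C) $ i $ j"
  by (simp add: symplectic_def sum_UNIV_blocks block_row_def matrix_matrix_mult_def transpose_def
      sum_negf)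

lemma trace_form_eq:
  "trace_form A B q = (\<Sum>i\<in>UNIV. \<Sum>c\<in>UNIV. block_row A B i c * q $ Inl i $ c)"
  by (simp add: trace_form_def trace_def matrix_matrix_mult_def transpose_def block_z_def block_w_def
      sum_UNIV_blocks block_row_def)

lemma linear_trace_form: "linear (trace_form A B)"
  by (simp add: linear_iff trace_form_eq algebra_simps sum.distrib scaleR_sum_right)

lemma sum_rotate:
  fixes f :: "'a \<Rightarrow> 'b \<Rightarrow> 'c \<Rightarrow> 'd::comm_monoid_add"
  shows "(\<Sum>x\<in>X. \<Sum>y\<in>Y. \<Sum>z\<in>Z. f x y z) = (\<Sum>z\<in>Z. \<Sum>x\<in>X. \<Sum>y\<in>Y. f x y z)"
  by (subst sum.swap[of _ Z]) (intro sum.cong refl sum.swap)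

text \<open>The basis sum contracts the two forms with \<open>J\<close> in the row index and in the column index of
  \<open>Z\<close>, which separates the dependence on \<open>p\<close> from that on the coefficient matrices.\<close>

lemma sum_basis_trace_forms:
  fixes p :: "complex^('n::finite + 'n)^('n + 'n)"
  assumes "is_orthonormal_basis ustar_algebra \<B>"
  shows "(\<Sum>Z\<in>\<B>. trace_form A B (p ** Z) * trace_form C D (p ** Z)) =
    (\<Sum>i\<in>UNIV. \<Sum>j\<in>UNIV. symplectic (($) (p $ Inl i)) (($) (p $ Inl j)) *
       symplectic (block_row A B i) (block_row C D j))"
proof -
  define coeff where "coeff A B r c = (\<Sum>i\<in>UNIV. p $ Inl i $ r * block_row A B i c)"
    for A B :: "complex^'n^'n" and r c
  have form: "trace_form A B (p ** Z) = (\<Sum>r\<in>UNIV. \<Sum>c\<in>UNIV. coeff A B r c * Z $ r $ c)" for A B Z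
  proof -
    have "trace_form A B (p ** Z) =
        (\<Sum>i\<in>UNIV. \<Sum>c\<in>UNIV. \<Sum>r\<in>UNIV. p $ Inl i $ r * block_row A B i c * Z $ r $ c)"
      by (simp add: trace_form_eq matrix_matrix_mult_def sum_distrib_left ac_simps)
    also have "\<dots> = (\<Sum>c\<in>UNIV. \<Sum>r\<in>UNIV. \<Sum>i\<in>UNIV. p $ Inl i $ r * block_row A B i c * Z $ r $ c)"
      by (rule sum_rotate[symmetric])
    also have "\<dots> = (\<Sum>r\<in>UNIV. \<Sum>c\<in>UNIV. \<Sum>i\<in>UNIV. p $ Inl i $ r * block_row A B i c * Z $ r $ c)"
      by (rule sum.swap)
    finally show ?thesis
      by (simp add: coeff_def sum_distrib_right)
  qed
  let ?term = "\<lambda>r c i j. (block_sign r * (p $ Inl i $ r * p $ Inl j $ other_block r)) *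
      (block_sign c * (block_row A B i c * block_row C D j (other_block c)))"
  have "(\<Sum>Z\<in>\<B>. trace_form A B (p ** Z) * trace_form C D (p ** Z)) =
      (\<Sum>r\<in>UNIV. \<Sum>c\<in>UNIV. block_sign r * block_sign c *
        (coeff A B r c * coeff C D (other_block r) (other_block c)))"
    unfolding form by (rule sum_basis_linear_forms[OF assms])
  also have "\<dots> = (\<Sum>r\<in>UNIV. \<Sum>c\<in>UNIV. \<Sum>i\<in>UNIV. \<Sum>j\<in>UNIV. ?term r c i j)"
    unfolding coeff_def sum_product by (simp only: sum_distrib_left ac_simps)
  also have "\<dots> = (\<Sum>i\<in>UNIV. \<Sum>r\<in>UNIV. \<Sum>c\<in>UNIV. \<Sum>j\<in>UNIV. ?term r c i j)"
    by (rule sum_rotate)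
  also have "\<dots> = (\<Sum>i\<in>UNIV. \<Sum>j\<in>UNIV. \<Sum>r\<in>UNIV. \<Sum>c\<in>UNIV. ?term r c i j)"
    by (intro sum.cong refl sum_rotate)
  finally show ?thesis
    by (simp only: symplectic_def sum_product)
qed

lemma sum_skew_symmetric_product_eq_0:
  fixes a b :: "'n::finite \<Rightarrow> 'n \<Rightarrow> complex"
  assumes "\<And>i j. a j i = - a i j" "\<And>i j. b j i = b i j"
  shows "(\<Sum>i\<in>UNIV. \<Sum>j\<in>UNIV. a i j * b i j) = 0"
proof -
  have "(\<Sum>i\<in>UNIV. \<Sum>j\<in>UNIV. a i j * b i j) = (\<Sum>i\<in>UNIV. \<Sum>j\<in>UNIV. a j i * b j i)"
    by (rule sum.swap)
  also have "\<dots> = (\<Sum>i\<in>UNIV. \<Sum>j\<in>UNIV. - (a i j * b i j))"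
    by (intro sum.cong refl, subst assms(1), subst assms(2)) simp
  finally show ?thesis
    by (simp add: sum_negf)
qed

text \<open>For \<open>\<kappa>\<close> the factor depending on \<open>p\<close> is skew in the row indices, while the hypothesis says that
  the factor depending on the coefficients is symmetric.\<close>

lemma eigenfamily_family_of:
  fixes M :: "((complex^'n^'n) \<times> (complex^'n^'n)) set"
  assumes M: "\<And>A B C D. (A, B) \<in> M \<Longrightarrow> (C, D) \<in> M \<Longrightarrow>
      transpose (A ** transpose D - B ** transpose C) = A ** transpose D - B ** transpose C"
  shows "eigenfamily ustar_group ustar_algebra (family_of M)"
proof -
  have family: "\<exists>A B. (A, B) \<in> M \<and> (\<forall>q\<in>ustar_group. \<phi> q = trace_form A B q)" if "\<phi> \<in> family_of M" for \<phi>
    using that by (fastforce simp: family_of_def trace_form_def)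
  have twice: "twice_differentiable_along ustar_group ustar_algebra \<phi>" if "\<phi> \<in> family_of M" for \<phi>
    using family[OF that] twice_differentiable_along_linear[OF linear_trace_form ustar_group_curve]
    by blast
  have tension: "tension \<B> \<phi> p = - \<phi> p"
    if B: "is_orthonormal_basis ustar_algebra \<B>" and \<phi>: "\<phi> \<in> family_of M" and p: "p \<in> ustar_group"
    for \<B> \<phi> p
  proof -
    obtain A B where AB: "\<And>q. q \<in> ustar_group \<Longrightarrow> \<phi> q = trace_form A B q"
      using family[OF \<phi>] by blast
    have "lie_deriv2 Z \<phi> p = trace_form A B (p ** (Z ** Z))" if "Z \<in> \<B>" for Z
      by (rule lie_deriv_linear(2)[OF linear_trace_form
            ustar_group_curve[OF p orthonormal_basis_mem[OF B that]] AB])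
    then have "tension \<B> \<phi> p = trace_form A B (p ** (\<Sum>Z\<in>\<B>. Z ** Z))"
      by (simp add: tension_def mat_mult.sum_right linear_sum[OF linear_trace_form])
    then show ?thesis
      using AB[OF p]
      by (simp add: sum_basis_squares[OF B] mat_mult.minus_right linear_neg[OF linear_trace_form])
  qed
  have kappa: "kappa \<B> \<phi> \<psi> p = 0"
    if B: "is_orthonormal_basis ustar_algebra \<B>" and \<phi>: "\<phi> \<in> family_of M" and \<psi>: "\<psi> \<in> family_of M"
      and p: "p \<in> ustar_group"
    for \<B> \<phi> \<psi> p
  proof -
    obtain A B where AB: "(A, B) \<in> M" "\<And>q. q \<in> ustar_group \<Longrightarrow> \<phi> q = trace_form A B q"
      using family[OF \<phi>] by blast
    obtain C D where CD: "(C, D) \<in> M" "\<And>q. q \<in> ustar_group \<Longrightarrow> \<psi> q = trace_form C D q"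
      using family[OF \<psi>] by blast
    have deriv: "lie_deriv Z \<phi> p = trace_form A B (p ** Z)" "lie_deriv Z \<psi> p = trace_form C D (p ** Z)"
      if "Z \<in> \<B>" for Z
      by (rule lie_deriv_linear(1)[OF linear_trace_form
            ustar_group_curve[OF p orthonormal_basis_mem[OF B that]]], erule AB CD)+
    have sym: "symplectic (block_row A B j) (block_row C D i) = symplectic (block_row A B i) (block_row C D j)"
      for i j
      using arg_cong[OF M[OF AB(1) CD(1)], of "\<lambda>X. X $ i $ j"]
      unfolding symplectic_block_row by (simp add: transpose_def)
    have "kappa \<B> \<phi> \<psi> p = (\<Sum>Z\<in>\<B>. trace_form A B (p ** Z) * trace_form C D (p ** Z))"
      by (simp add: kappa_def deriv)
    also have "\<dots> = 0"
      unfolding sum_basis_trace_forms[OF B]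
      by (rule sum_skew_symmetric_product_eq_0[OF symplectic_skew sym])
    finally show ?thesis .
  qed
  show ?thesis
    unfolding eigenfamily_def
    using twice tension kappa by (intro conjI exI[of _ "-1"] exI[of _ 0]) auto
qed

theorem theorem5p2:
  fixes M :: "((complex^'n^'n) \<times> (complex^'n^'n)) set"
  assumes "M \<noteq> {}"
    and "\<And>A B C D. (A, B) \<in> M \<Longrightarrow> (C, D) \<in> M \<Longrightarrow>
           transpose (A ** transpose B) = A ** transpose B \<and>
           transpose (A ** transpose D - B ** transpose C) = A ** transpose D - B ** transpose C \<and>
           transpose (C ** transpose D) = C ** transpose D"
  shows "eigenfamily ustar_group ustar_algebra (family_of M) \<and>
         eigenfamily ustar_group ustar_algebra (complex_span_on ustar_group (family_of M))"
proof -
  have "eigenfamily ustar_group ustar_algebra (family_of M)"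
    using assms(2) by (intro eigenfamily_family_of) blast
  then show ?thesis
    using eigenfamily_complex_span[OF _ ustar_group_curve] by blast
qed

end
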